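(* Let $\alpha,\beta>-1$ and let $P_n^{(\alpha,\beta)}$ be the Jacobi polynomials. The operator $L$ on polynomials given by $$(Lf)(x)=(1-x^2)f'(x)-\tfrac12\bigl(\alpha-\beta+(\alpha+\beta+2)x\bigr)f(x)$$ satisfies $\langle Lf,g\rangle=-\langle f,Lg\rangle$ for all polynomials $f,g$, where $\langle f,g\rangle=\int_{-1}^1f(x)g(x)(1-x)^\alpha(1+x)^\beta\,dx$. Moreover: (i) for $-1<x<1$, $(Lf)(x)=(1-x)^{-\frac12\alpha+\frac12}(1+x)^{-\frac12\beta+\frac12}\,\frac{d}{dx}\Bigl((1-x)^{\frac12\alpha+\frac12}(1+x)^{\frac12\beta+\frac12}f(x)\Bigr)$; (ii) $L=DX-XD$, where $(Xf)(x)=xf(x)$ and $D=\tfrac12(1-x^2)\frac{d^2}{dx^2}+\tfrac12\bigl(\beta-\alpha-(\alpha+\beta+2)x\bigr)\frac{d}{dx}$; (iii) for all $n\ge0$ the structure relation holds: $$\Bigl((1-x^2)\frac d{dx}-\tfrac12\bigl(\alpha-\beta+(\alpha+\beta+2)x\bigr)\Bigr)P_n^{(\alpha,\beta)}(x)=-\frac{(n+1)(n+\alpha+\beta+1)}{2n+\alpha+\beta+1}\,P_{n+1}^{(\alpha,\beta)}(x)+\frac{(n+\alpha)(n+\beta)}{2n+\alpha+\beta+1}\,P_{n-1}^{(\alpha,\beta)}(x).$$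
   Context: $P_n^{(\alpha,\beta)}$ are the Jacobi polynomials in the standard normalization $P_n^{(\alpha,\beta)}(1)=\frac{(\alpha+1)(\alpha+2)\cdots(\alpha+n)}{n!}$, orthogonal on $[-1,1]$ with respect to the weight $(1-x)^\alpha(1+x)^\beta$. Convention: $P_{-1}^{(\alpha,\beta)}:=0$; for $n=0$ the $P_{-1}$ term is $0$ and the quotient $(\alpha+\beta+1)/(\alpha+\beta+1)$ is read as $1$. *)

theory Defs
  imports "HOL-Analysis.Analysis" "HOL-Computational_Algebra.Polynomial"
begin

definition jacobi_inner :: "real \<Rightarrow> real \<Rightarrow> real poly \<Rightarrow> real poly \<Rightarrow> real" where
  "jacobi_inner \<alpha> \<beta> f g =
     integral {-1..1} (\<lambda>x. poly f x * poly g x * (1 - x) powr \<alpha> * (1 + x) powr \<beta>)"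

definition jacobi_system :: "real \<Rightarrow> real \<Rightarrow> (nat \<Rightarrow> real poly) \<Rightarrow> bool" where
  "jacobi_system \<alpha> \<beta> P \<longleftrightarrow>
     (\<forall>n. degree (P n) = n) \<and>
     (\<forall>m n. m \<noteq> n \<longrightarrow> jacobi_inner \<alpha> \<beta> (P m) (P n) = 0) \<and>
     (\<forall>n. poly (P n) 1 = (\<Prod>i=1..n. \<alpha> + real i) / fact n)"

(* The index is an integer so that the convention P_{-1} = 0 is part of the definition.
   For \<alpha>, \<beta> > -1 the system described by THE exists and is unique. *)
definition jacobi_poly :: "real \<Rightarrow> real \<Rightarrow> int \<Rightarrow> real poly" where
  "jacobi_poly \<alpha> \<beta> k = (if k < 0 then 0 else (THE P. jacobi_system \<alpha> \<beta> P) (nat k))"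

definition jacobi_L :: "real \<Rightarrow> real \<Rightarrow> real poly \<Rightarrow> real poly" where
  "jacobi_L \<alpha> \<beta> f =
     [:1, 0, -1:] * pderiv f - smult (1/2) ([:\<alpha> - \<beta>, \<alpha> + \<beta> + 2:] * f)"

definition jacobi_D :: "real \<Rightarrow> real \<Rightarrow> real poly \<Rightarrow> real poly" where
  "jacobi_D \<alpha> \<beta> f =
     smult (1/2) ([:1, 0, -1:] * pderiv (pderiv f)) +
     smult (1/2) ([:\<beta> - \<alpha>, - (\<alpha> + \<beta> + 2):] * pderiv f)"

definition mult_X :: "real poly \<Rightarrow> real poly" where
  "mult_X f = [:0, 1:] * f"

end

theory Submission imports Defs begin

text \<open>
  Antisymmetry of \<open>L\<close> and symmetry of \<open>D\<close> both come from integrating the derivative of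
  \<open>(1 - x) powr (\<alpha> + 1) * (1 + x) powr (\<beta> + 1) * h x\<close>, which vanishes at both endpoints: take
  \<open>h = f g\<close> for \<open>L\<close> and \<open>h = f' g - f g'\<close> for \<open>D\<close>.
  The hypergeometric polynomials in \<open>t = (x - 1) / 2\<close> are eigenfunctions of \<open>D\<close> with pairwise
  distinct eigenvalues, hence orthogonal; by positive definiteness they are the only Jacobi system.
  The structure relation is then an identity between the coefficients of the powers of \<open>t\<close>.
\<close>

section \<open>The weight and its moment functional\<close>

definition jacobi_weight :: "real \<Rightarrow> real \<Rightarrow> real \<Rightarrow> real" where
  "jacobi_weight \<alpha> \<beta> x = (1 - x) powr \<alpha> * (1 + x) powr \<beta>"

text \<open>The inner product depends only on the product of its arguments, so a polynomial identity
  between products can be pushed through one linear functional.\<close>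

definition jacobi_functional :: "real \<Rightarrow> real \<Rightarrow> real poly \<Rightarrow> real" where
  "jacobi_functional \<alpha> \<beta> h = integral {-1..1} (\<lambda>x. poly h x * jacobi_weight \<alpha> \<beta> x)"

lemma jacobi_inner_eq_functional:
  "jacobi_inner \<alpha> \<beta> f g = jacobi_functional \<alpha> \<beta> (f * g)"
  by (simp add: jacobi_inner_def jacobi_functional_def jacobi_weight_def mult.assoc)

text \<open>The substitution t = (1 + x) / 2 turns the Beta integral with parameters \<beta> + 1 and
  \<alpha> + 1 into this one, up to powers of 2.\<close>

lemma jacobi_weight_integrable:
  assumes "\<alpha> > -1" "\<beta> > -1"
  shows "jacobi_weight \<alpha> \<beta> integrable_on {-1..1}"
proof -
  have "((\<lambda>t. t powr ((\<beta>+1) - 1) * (1 - t) powr ((\<alpha>+1) - 1)) has_integral Beta (\<beta>+1) (\<alpha>+1)) (cbox 0 1)"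
    using has_integral_Beta_real[of "\<beta>+1" "\<alpha>+1"] assms by simp
  from has_integral_affinity[OF this, of "1/2" "1/2"]
  have "(\<lambda>x. ((1 + x)/2) powr \<beta> * ((1 - x)/2) powr \<alpha>) integrable_on ((\<lambda>x. 2 * x - 1) ` {0..1})"
    by (auto simp: integrable_on_def field_simps scaleR_conv_of_real)
  moreover have "(\<lambda>x. 2 * x - 1) ` {0..1::real} = {-1..1}"
    using image_affinity_atLeastAtMost[of 2 "-1" "0::real" 1] by simp
  ultimately have "(\<lambda>x. ((1 + x)/2) powr \<beta> * ((1 - x)/2) powr \<alpha>) integrable_on {-1..1}"
    by simp
  hence "(\<lambda>x. (2 powr \<alpha> * 2 powr \<beta>) * (((1 + x)/2) powr \<beta> * ((1 - x)/2) powr \<alpha>)) integrable_on {-1..1}"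
    by (rule integrable_on_mult_right)
  thus ?thesis
    by (rule integrable_eq) (simp add: jacobi_weight_def powr_divide)
qed

lemma jacobi_weight_nonneg: "jacobi_weight \<alpha> \<beta> x \<ge> 0"
  by (simp add: jacobi_weight_def)

lemma poly_jacobi_weight_integrable:
  assumes "\<alpha> > -1" "\<beta> > -1"
  shows "(\<lambda>x. poly h x * jacobi_weight \<alpha> \<beta> x) integrable_on {-1..1}"
proof -
  \<comment> \<open>The weight may be unbounded near the endpoints, so continuity cannot give
    integrability; nonnegativity makes it absolutely integrable, and a bounded measurable factor
    preserves that.\<close>
  have w: "jacobi_weight \<alpha> \<beta> absolutely_integrable_on {-1..1}"
    using jacobi_weight_integrable[OF assms]
    by (rule nonnegative_absolutely_integrable_1) (simp add: jacobi_weight_nonneg)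
  have c: "continuous_on {-1..1} (poly h)"
    by (intro continuous_intros)
  have "(\<lambda>x. poly h x * jacobi_weight \<alpha> \<beta> x) absolutely_integrable_on {-1..1}"
    using c w
    by (intro absolutely_integrable_bounded_measurable_product_real)
       (auto intro!: continuous_imp_measurable_on_sets_lebesgue compact_imp_bounded
          compact_continuous_image)
  thus ?thesis
    using set_lebesgue_integral_eq_integral(1) by blast
qed

lemma
  assumes "\<alpha> > -1" "\<beta> > -1"
  shows jacobi_functional_add:
      "jacobi_functional \<alpha> \<beta> (f + g) = jacobi_functional \<alpha> \<beta> f + jacobi_functional \<alpha> \<beta> g"
    and jacobi_functional_diff:
      "jacobi_functional \<alpha> \<beta> (f - g) = jacobi_functional \<alpha> \<beta> f - jacobi_functional \<alpha> \<beta> g"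
  using poly_jacobi_weight_integrable[OF assms]
  by (simp_all add: jacobi_functional_def algebra_simps integral_add integral_diff)

lemma jacobi_functional_smult:
  "jacobi_functional \<alpha> \<beta> (smult c f) = c * jacobi_functional \<alpha> \<beta> f"
  by (simp add: jacobi_functional_def mult.assoc)

lemma jacobi_functional_square_eq_0D:
  assumes "\<alpha> > -1" "\<beta> > -1" and z: "jacobi_functional \<alpha> \<beta> (q * q) = 0"
  shows "q = 0"
proof -
  let ?f = "\<lambda>x. poly (q * q) x * jacobi_weight \<alpha> \<beta> x"
  have nn: "?f x \<ge> 0" for x by (simp add: jacobi_weight_nonneg)
  have int: "?f integrable_on {-1..1}"
    by (rule poly_jacobi_weight_integrable[OF assms(1,2)])
  \<comment> \<open>On this smaller interval the weight is continuous and positive, while it may be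
    singular at -1 and 1. Vanishing of \<open>q\<close> here already gives infinitely many
    roots.\<close>
  have cont: "continuous_on {-1/2..1/2} ?f"
    unfolding jacobi_weight_def by (intro continuous_intros) auto
  have int': "?f integrable_on {-1/2..1/2}"
    by (rule integrable_continuous_real[OF cont])
  have "integral {-1/2..1/2} ?f \<le> integral {-1..1} ?f"
    by (rule integral_subset_le) (use int int' nn in auto)
  moreover have "integral {-1/2..1/2} ?f \<ge> 0"
    by (rule integral_nonneg[OF int']) (use nn in auto)
  ultimately have "integral {-1/2..1/2} ?f = 0"
    using z by (simp add: jacobi_functional_def)
  hence "(?f has_integral 0) (cbox (-1/2) (1/2))"
    using int' by (metis has_integral_integral interval_cbox)
  hence "?f x = 0" if "x \<in> {-1/2..1/2}" for x
    by (rule has_integral_0_cbox_imp_0[rotated 2]) (use cont nn that in auto)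
  hence "{-1/2..1/2} \<subseteq> {x. poly q x = 0}"
    by (auto simp: jacobi_weight_def)
  hence "infinite {x. poly q x = 0}"
    by (rule infinite_super) (simp add: infinite_Icc)
  thus ?thesis
    using poly_roots_finite by blast
qed

section \<open>Integration by parts for \<open>L\<close> and \<open>D\<close>\<close>

text \<open>With w the weight, the Pearson equation ((1 - x^2) w)' = (\<beta> - \<alpha> - (\<alpha>
  + \<beta> + 2) x) w shows that the integrand is the derivative of (1 - x^2) w h.\<close>

lemma jacobi_functional_total_derivative:
  assumes "\<alpha> > -1" "\<beta> > -1"
  shows "jacobi_functional \<alpha> \<beta> ([:1, 0, -1:] * pderiv h + [:\<beta> - \<alpha>, - (\<alpha> + \<beta> + 2):] * h) = 0"
proof -
  let ?F = "\<lambda>x. (1 - x) powr (\<alpha> + 1) * (1 + x) powr (\<beta> + 1) * poly h x"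
  let ?f = "\<lambda>x. poly ([:1, 0, -1:] * pderiv h + [:\<beta> - \<alpha>, - (\<alpha> + \<beta> + 2):] * h) x
                 * jacobi_weight \<alpha> \<beta> x"
  have "(?f has_integral (?F 1 - ?F (-1))) {-1..1}"
  \<comment> \<open>The integrand can blow up at the endpoints; \<open>?F\<close> is still
    continuous there because the exponents \<alpha> + 1 and \<beta> + 1 are positive.\<close>
  proof (rule fundamental_theorem_of_calculus_interior)
    show "continuous_on {-1..1} ?F"
      using assms by (intro continuous_intros continuous_on_powr') auto
    show "(?F has_vector_derivative ?f x) (at x)" if "x \<in> {-1<..<1}" for x
    proof -
      have *: "(1 - x) powr (\<alpha> + 1) = (1 - x) * (1 - x) powr \<alpha>"
        "(1 + x) powr (\<beta> + 1) = (1 + x) * (1 + x) powr \<beta>"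
        using that by (simp_all add: powr_add)
      have "(?F has_real_derivative ?f x) (at x)"
        using that
        by (auto intro!: derivative_eq_intros simp: * jacobi_weight_def) (simp add: algebra_simps)
      thus ?thesis by (simp add: has_real_derivative_iff_has_vector_derivative)
    qed
  qed auto
  thus ?thesis
    by (auto simp: jacobi_functional_def dest: integral_unique)
qed

text \<open>The zeroth order term of \<open>L\<close> is half the linear factor in the Pearson
  equation, so its two occurrences add up to the full factor.\<close>

lemma jacobi_L_antisymmetric:
  assumes "\<alpha> > -1" "\<beta> > -1"
  shows "jacobi_inner \<alpha> \<beta> (jacobi_L \<alpha> \<beta> f) g = - jacobi_inner \<alpha> \<beta> f (jacobi_L \<alpha> \<beta> g)"
proof -
  have "jacobi_L \<alpha> \<beta> f * g + f * jacobi_L \<alpha> \<beta> g =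
      [:1, 0, -1:] * pderiv (f * g) + [:\<beta> - \<alpha>, - (\<alpha> + \<beta> + 2):] * (f * g)"
    by (rule poly_eq_poly_eq_iff[THEN iffD1], rule ext)
       (simp add: jacobi_L_def pderiv_mult field_simps)
  thus ?thesis
    using jacobi_functional_total_derivative[OF assms, of "f * g"]
      jacobi_functional_add[OF assms, of "jacobi_L \<alpha> \<beta> f * g" "f * jacobi_L \<alpha> \<beta> g"]
    by (simp add: jacobi_inner_eq_functional)
qed

lemma jacobi_D_symmetric:
  assumes "\<alpha> > -1" "\<beta> > -1"
  shows "jacobi_inner \<alpha> \<beta> (jacobi_D \<alpha> \<beta> f) g = jacobi_inner \<alpha> \<beta> f (jacobi_D \<alpha> \<beta> g)"
proof -
  \<comment> \<open>The Wronskian: in its derivative the products of first derivatives cancel,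
    leaving the second order part of \<open>D\<close>.\<close>
  let ?h = "pderiv f * g - f * pderiv g"
  have "smult 2 (jacobi_D \<alpha> \<beta> f * g - f * jacobi_D \<alpha> \<beta> g) =
      [:1, 0, -1:] * pderiv ?h + [:\<beta> - \<alpha>, - (\<alpha> + \<beta> + 2):] * ?h"
    by (rule poly_eq_poly_eq_iff[THEN iffD1], rule ext)
       (simp add: jacobi_D_def pderiv_mult pderiv_diff field_simps)
  hence "2 * jacobi_functional \<alpha> \<beta> (jacobi_D \<alpha> \<beta> f * g - f * jacobi_D \<alpha> \<beta> g) = 0"
    using jacobi_functional_total_derivative[OF assms, of ?h]
    by (metis jacobi_functional_smult)
  thus ?thesis
    using jacobi_functional_diff[OF assms]
    by (simp add: jacobi_inner_eq_functional)
qed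

section \<open>Uniqueness of the Jacobi system\<close>

text \<open>Induction on \<open>m\<close>, removing the top coefficient of \<open>f\<close> by a
  multiple of \<open>P m\<close>. Bounding by vanishing coefficients instead of the degree makes
  \<open>m = 0\<close> mean \<open>f = 0\<close>.\<close>

lemma jacobi_system_orthogonal_lower_degree:
  assumes "\<alpha> > -1" "\<beta> > -1" and P: "jacobi_system \<alpha> \<beta> P"
    and "m \<le> n" "\<And>i. i \<ge> m \<Longrightarrow> coeff f i = 0"
  shows "jacobi_functional \<alpha> \<beta> (f * P n) = 0"
  using assms(4,5)
proof (induction m arbitrary: f)
  case 0
  hence "f = 0" by (simp add: poly_eq_iff)
  thus ?case by (simp add: jacobi_functional_def)
next
  case (Suc m)
  have deg: "degree (P m) = m" and orth: "jacobi_functional \<alpha> \<beta> (P m * P n) = 0"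
    using P Suc.prems(1) by (auto simp: jacobi_system_def jacobi_inner_eq_functional)
  have lc: "coeff (P m) m \<noteq> 0"
  proof (cases "m = 0")
    \<comment> \<open>Degree 0 does not exclude the zero polynomial; the normalization at 1
      does.\<close>
    case True
    obtain c where c: "P 0 = [:c:]" using P by (metis jacobi_system_def degree_eq_zeroE)
    have "poly (P 0) 1 = 1" using P by (simp add: jacobi_system_def)
    thus ?thesis using c True by simp
  next
    case False
    thus ?thesis using deg by (metis leading_coeff_0_iff degree_0)
  qed
  define c where "c = coeff f m / coeff (P m) m"
  have "coeff (f - smult c (P m)) i = 0" if "i \<ge> m" for i
  proof (cases "i = m")
    case True
    thus ?thesis using lc by (simp add: c_def)
  next
    case False
    thus ?thesis using that Suc.prems(2)[of i] deg by (simp add: coeff_eq_0)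
  qed
  hence "jacobi_functional \<alpha> \<beta> ((f - smult c (P m)) * P n) = 0"
    using Suc by simp
  thus ?case
    using orth by (simp add: left_diff_distrib jacobi_functional_diff[OF assms(1,2)] jacobi_functional_smult)
qed

text \<open>Cross-multiplying by leading coefficients gives \<open>r\<close> of lower degree,
  orthogonal to \<open>P n\<close> and \<open>Q n\<close> and hence to itself. So
  \<open>r = 0\<close>, and the common nonzero value at 1 fixes the scale.\<close>

lemma jacobi_system_unique:
  assumes ab: "\<alpha> > -1" "\<beta> > -1" and P: "jacobi_system \<alpha> \<beta> P" and Q: "jacobi_system \<alpha> \<beta> Q"
  shows "P = Q"
proof
  fix n
  define a b where "a = coeff (P n) n" and "b = coeff (Q n) n"
  define r where "r = smult b (P n) - smult a (Q n)"
  have deg: "degree (P n) = n" "degree (Q n) = n"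
    using P Q by (auto simp: jacobi_system_def)
  have val: "poly (P n) 1 = poly (Q n) 1"
    using P Q by (auto simp: jacobi_system_def)
  have val0: "poly (P n) 1 \<noteq> 0"
  proof -
    have "(\<Prod>i=1..n. \<alpha> + real i) > 0"
      using ab by (intro prod_pos) auto
    moreover have "poly (P n) 1 = (\<Prod>i=1..n. \<alpha> + real i) / fact n"
      using P by (simp add: jacobi_system_def)
    ultimately show ?thesis
      by (metis divide_eq_0_iff fact_nonzero less_irrefl)
  qed
  have low: "coeff r i = 0" if "i \<ge> n" for i
    using that deg by (cases "i = n") (auto simp: r_def a_def b_def coeff_eq_0)
  have "jacobi_functional \<alpha> \<beta> (r * P n) = 0" "jacobi_functional \<alpha> \<beta> (r * Q n) = 0"
    using low by (auto intro!: jacobi_system_orthogonal_lower_degree[OF ab _ order_refl] P Q)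
  hence "jacobi_functional \<alpha> \<beta> (r * r) = 0"
    by (subst (2) r_def)
       (simp add: right_diff_distrib jacobi_functional_diff[OF ab] jacobi_functional_smult)
  hence "r = 0"
    by (rule jacobi_functional_square_eq_0D[OF ab])
  hence eq: "smult b (P n) = smult a (Q n)" by (simp add: r_def)
  hence "b * poly (P n) 1 = a * poly (Q n) 1" by (metis poly_smult)
  hence "a = b" using val val0 by simp
  moreover have "a \<noteq> 0"
    using deg val0 by (metis a_def leading_coeff_0_iff poly_0)
  ultimately show "P n = Q n"
    using eq by (metis smult_cancel)
qed

section \<open>Existence: the hypergeometric polynomials\<close>

text \<open>
  The coefficient of \<open>t ^ k\<close> in
  \<open>(\<alpha> + 1)\<^sub>n / n! * \<^sub>2F\<^sub>1 (- n, n + \<alpha> + \<beta> + 1; \<alpha> + 1; - t)\<close>;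
  the factor \<open>pochhammer (- n) k\<close> makes it vanish for \<open>k > n\<close>.
\<close>

definition jacobi_coeff :: "real \<Rightarrow> real \<Rightarrow> nat \<Rightarrow> nat \<Rightarrow> real" where
  "jacobi_coeff \<alpha> \<beta> n k = pochhammer (\<alpha> + 1) n / fact n *
     ((-1) ^ k * pochhammer (- real n) k * pochhammer (real n + \<alpha> + \<beta> + 1) k
       / (pochhammer (\<alpha> + 1) k * fact k))"

definition jacobi_shifted :: "real \<Rightarrow> real \<Rightarrow> nat \<Rightarrow> real poly" where
  "jacobi_shifted \<alpha> \<beta> n = (\<Sum>k\<le>n. monom (jacobi_coeff \<alpha> \<beta> n k) k)"

definition jacobi_explicit :: "real \<Rightarrow> real \<Rightarrow> nat \<Rightarrow> real poly" where
  "jacobi_explicit \<alpha> \<beta> n = jacobi_shifted \<alpha> \<beta> n \<circ>\<^sub>p [:-1/2, 1/2:]"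

lemma pochhammer_neg_nat_eq_0: "n < k \<Longrightarrow> pochhammer (- real n) k = 0"
  by (simp add: pochhammer_of_nat_eq_0_iff)

lemma coeff_jacobi_shifted: "coeff (jacobi_shifted \<alpha> \<beta> n) k = jacobi_coeff \<alpha> \<beta> n k"
  by (simp add: jacobi_shifted_def coeff_sum jacobi_coeff_def pochhammer_neg_nat_eq_0)

lemma degree_jacobi_shifted:
  assumes "\<alpha> > -1" "\<beta> > -1"
  shows "degree (jacobi_shifted \<alpha> \<beta> n) = n"
proof (rule antisym)
  show "degree (jacobi_shifted \<alpha> \<beta> n) \<le> n"
    by (rule degree_le) (simp add: coeff_jacobi_shifted jacobi_coeff_def pochhammer_neg_nat_eq_0)
  have "pochhammer (real n + \<alpha> + \<beta> + 1) n \<noteq> 0"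
  \<comment> \<open>For \<open>n = 0\<close> the base \<alpha> + \<beta> + 1 may be nonpositive, but
    the empty Pochhammer product is 1.\<close>
  proof (cases "n = 0")
    case False
    hence "real n + \<alpha> + \<beta> + 1 > 0" using assms by (cases n) auto
    thus ?thesis using pochhammer_pos by (metis less_irrefl)
  qed simp
  moreover have "pochhammer (- real n) n \<noteq> 0"
    by (simp add: pochhammer_of_nat_eq_0_iff)
  moreover have "pochhammer (\<alpha> + 1) n > 0"
    using assms by (intro pochhammer_pos) auto
  ultimately have "coeff (jacobi_shifted \<alpha> \<beta> n) n \<noteq> 0"
    by (simp add: coeff_jacobi_shifted jacobi_coeff_def)
  thus "n \<le> degree (jacobi_shifted \<alpha> \<beta> n)"
    by (rule le_degree)
qed

text \<open>The ratio of consecutive hypergeometric terms, cleared of denominators.\<close>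

lemma jacobi_coeff_Suc:
  assumes "\<alpha> > -1"
  shows "(real k + 1) * (\<alpha> + 1 + real k) * jacobi_coeff \<alpha> \<beta> n (Suc k) =
    (real n - real k) * (real n + real k + \<alpha> + \<beta> + 1) * jacobi_coeff \<alpha> \<beta> n k"
proof -
  have "pochhammer (\<alpha> + 1) k > 0" "\<alpha> + 1 + real k > 0"
    using assms by (auto intro!: pochhammer_pos)
  thus ?thesis
    by (simp add: jacobi_coeff_def pochhammer_Suc divide_simps del: of_nat_Suc)
       (simp add: algebra_simps)
qed

text \<open>The hypergeometric equation in t. With s = \<alpha> + \<beta> + 1, comparing
  coefficients of t^k reduces it to the two-term recurrence via n (n + s) - k (k + s) = (n - k) (n +
  k + s).\<close>

lemma jacobi_shifted_ode:
  assumes "\<alpha> > -1"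
  shows "[:0, 1, 1:] * pderiv (pderiv (jacobi_shifted \<alpha> \<beta> n))
      + [:\<alpha> + 1, \<alpha> + \<beta> + 2:] * pderiv (jacobi_shifted \<alpha> \<beta> n)
    = smult (real n * (real n + \<alpha> + \<beta> + 1)) (jacobi_shifted \<alpha> \<beta> n)"
proof (rule poly_eqI)
  fix k
  show "coeff ([:0, 1, 1:] * pderiv (pderiv (jacobi_shifted \<alpha> \<beta> n))
      + [:\<alpha> + 1, \<alpha> + \<beta> + 2:] * pderiv (jacobi_shifted \<alpha> \<beta> n)) k
    = coeff (smult (real n * (real n + \<alpha> + \<beta> + 1)) (jacobi_shifted \<alpha> \<beta> n)) k"
  proof (cases k)
    case 0
    thus ?thesis using jacobi_coeff_Suc[OF assms, of 0 \<beta> n]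
      by (simp add: coeff_pderiv coeff_jacobi_shifted coeff_pCons algebra_simps)
  next
    case (Suc j)
    thus ?thesis using jacobi_coeff_Suc[OF assms, of k \<beta> n]
      by (cases j) (simp_all add: coeff_pderiv coeff_jacobi_shifted coeff_pCons algebra_simps)
  qed
qed

lemma poly_jacobi_explicit:
  "poly (jacobi_explicit \<alpha> \<beta> n) x = poly (jacobi_shifted \<alpha> \<beta> n) ((x - 1) / 2)"
  by (simp add: jacobi_explicit_def poly_pcompose diff_divide_distrib)

lemma poly_pderiv_jacobi_explicit:
  "poly (pderiv (jacobi_explicit \<alpha> \<beta> n)) x = poly (pderiv (jacobi_shifted \<alpha> \<beta> n)) ((x - 1) / 2) / 2"
  by (simp add: jacobi_explicit_def pderiv_pcompose poly_pcompose pderiv_pCons diff_divide_distrib)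

lemma poly_pderiv2_jacobi_explicit:
  "poly (pderiv (pderiv (jacobi_explicit \<alpha> \<beta> n))) x
    = poly (pderiv (pderiv (jacobi_shifted \<alpha> \<beta> n))) ((x - 1) / 2) / 4"
  by (simp add: jacobi_explicit_def pderiv_pcompose poly_pcompose pderiv_pCons pderiv_mult pderiv_smult diff_divide_distrib)

text \<open>For x = 1 + 2 t, 1 - x^2 = -4 t (1 + t) and \<beta> - \<alpha> - (\<alpha> + \<beta> +
  2) x = -2 (\<alpha> + 1 + (\<alpha> + \<beta> + 2) t); with the chain rule factors,
  \<open>D\<close> is -1/2 times the operator of \<open>jacobi_shifted_ode\<close>.\<close>

lemma jacobi_D_jacobi_explicit:
  assumes "\<alpha> > -1"
  shows "jacobi_D \<alpha> \<beta> (jacobi_explicit \<alpha> \<beta> n) =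
    smult (- (real n * (real n + \<alpha> + \<beta> + 1)) / 2) (jacobi_explicit \<alpha> \<beta> n)"
proof (rule poly_eq_poly_eq_iff[THEN iffD1], rule ext)
  fix x :: real
  define t where "t = (x - 1) / 2"
  have x: "x = 1 + 2 * t" by (simp add: t_def field_simps)
  have "poly ([:0, 1, 1:] * pderiv (pderiv (jacobi_shifted \<alpha> \<beta> n))
      + [:\<alpha> + 1, \<alpha> + \<beta> + 2:] * pderiv (jacobi_shifted \<alpha> \<beta> n)) t
    = poly (smult (real n * (real n + \<alpha> + \<beta> + 1)) (jacobi_shifted \<alpha> \<beta> n)) t"
    by (simp only: jacobi_shifted_ode[OF assms])
  thus "poly (jacobi_D \<alpha> \<beta> (jacobi_explicit \<alpha> \<beta> n)) x =
      poly (smult (- (real n * (real n + \<alpha> + \<beta> + 1)) / 2) (jacobi_explicit \<alpha> \<beta> n)) x"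
    unfolding jacobi_D_def
    by (simp add: poly_jacobi_explicit poly_pderiv_jacobi_explicit poly_pderiv2_jacobi_explicit
          flip: t_def) (simp add: x field_simps)
qed

lemma jacobi_system_explicit:
  assumes "\<alpha> > -1" "\<beta> > -1"
  shows "jacobi_system \<alpha> \<beta> (jacobi_explicit \<alpha> \<beta>)"
  unfolding jacobi_system_def
proof (intro conjI allI impI)
  fix n
  show "degree (jacobi_explicit \<alpha> \<beta> n) = n"
    by (simp add: jacobi_explicit_def degree_pcompose degree_jacobi_shifted[OF assms])
  show "poly (jacobi_explicit \<alpha> \<beta> n) 1 = (\<Prod>i=1..n. \<alpha> + real i) / fact n"
  proof -
    have "poly (jacobi_explicit \<alpha> \<beta> n) 1 = pochhammer (\<alpha> + 1) n / fact n"
      by (simp add: poly_jacobi_explicit poly_0_coeff_0 coeff_jacobi_shifted jacobi_coeff_def)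
    moreover have "pochhammer (\<alpha> + 1) n = (\<Prod>i=1..n. \<alpha> + real i)"
      by (induction n) (simp_all add: pochhammer_Suc add_ac)
    ultimately show ?thesis by simp
  qed
next
  fix m n :: nat
  let ?P = "jacobi_explicit \<alpha> \<beta>"
  assume "m \<noteq> n"
  define ev where "ev = (\<lambda>n::nat. real n * (real n + \<alpha> + \<beta> + 1))"
  have "- ev m / 2 * jacobi_inner \<alpha> \<beta> (?P m) (?P n) = - ev n / 2 * jacobi_inner \<alpha> \<beta> (?P m) (?P n)"
    using jacobi_D_symmetric[OF assms, of "?P m" "?P n"]
    unfolding jacobi_D_jacobi_explicit[OF assms(1)] jacobi_inner_eq_functional
      mult_smult_left mult_smult_right jacobi_functional_smult ev_def .
  moreover have "ev m - ev n = (real m - real n) * (real m + real n + \<alpha> + \<beta> + 1)"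
    by (simp add: ev_def algebra_simps)
  \<comment> \<open>Distinct naturals have sum at least 1, and \<alpha> + \<beta> > -2; hence the
    eigenvalues differ.\<close>
  moreover have "real m + real n + \<alpha> + \<beta> + 1 > 0"
    using \<open>m \<noteq> n\<close> assms by (cases m; cases n) auto
  ultimately show "jacobi_inner \<alpha> \<beta> (?P m) (?P n) = 0"
    using \<open>m \<noteq> n\<close> by auto
qed

lemma jacobi_poly_eq_explicit:
  assumes "\<alpha> > -1" "\<beta> > -1"
  shows "jacobi_poly \<alpha> \<beta> k = (if k < 0 then 0 else jacobi_explicit \<alpha> \<beta> (nat k))"
proof -
  have "(THE P. jacobi_system \<alpha> \<beta> P) = jacobi_explicit \<alpha> \<beta>"
    using jacobi_system_explicit[OF assms] jacobi_system_unique[OF assms] by blast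
  thus ?thesis by (simp add: jacobi_poly_def)
qed

section \<open>The structure relation\<close>

text \<open>The constant term in t, that is, the relation at x = 1. Taking \<open>n = Suc m\<close>
  keeps \<open>n - 1\<close> natural and the denominator positive.\<close>

lemma jacobi_coeff_structure_0:
  assumes "\<alpha> > -1" "\<beta> > -1"
  shows "- (\<alpha> + 1) * jacobi_coeff \<alpha> \<beta> (Suc m) 0 =
    - ((real m + 2) * (real m + \<alpha> + \<beta> + 2) / (2 * real m + \<alpha> + \<beta> + 3)) * jacobi_coeff \<alpha> \<beta> (Suc (Suc m)) 0
    + (real m + 1 + \<alpha>) * (real m + 1 + \<beta>) / (2 * real m + \<alpha> + \<beta> + 3) * jacobi_coeff \<alpha> \<beta> m 0"
proof -
  have "2 * real m + \<alpha> + \<beta> + 3 > 0" using assms by linarith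
  thus ?thesis
    by (simp add: jacobi_coeff_def pochhammer_Suc divide_simps) (simp add: algebra_simps)
qed

text \<open>The coefficient of t^(k + 1). All four hypergeometric coefficients share a factor
  \<open>K\<close>; what remains is the rational identity behind \<open>key\<close>.\<close>

lemma jacobi_coeff_structure_Suc:
  assumes "\<alpha> > -1" "\<beta> > -1"
  shows "- (2 * real k + \<alpha> + 3) * jacobi_coeff \<alpha> \<beta> (Suc m) (Suc k)
      - (2 * real k + \<alpha> + \<beta> + 2) * jacobi_coeff \<alpha> \<beta> (Suc m) k =
    - ((real m + 2) * (real m + \<alpha> + \<beta> + 2) / (2 * real m + \<alpha> + \<beta> + 3))
        * jacobi_coeff \<alpha> \<beta> (Suc (Suc m)) (Suc k)
    + (real m + 1 + \<alpha>) * (real m + 1 + \<beta>) / (2 * real m + \<alpha> + \<beta> + 3) * jacobi_coeff \<alpha> \<beta> m (Suc k)"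
proof (cases k)
  \<comment> \<open>The common factor is built from Pochhammer symbols of length
    \<open>k - 1\<close>, so \<open>k = 0\<close> is computed directly.\<close>
  case 0
  have "2 * real m + \<alpha> + \<beta> + 3 > 0" "\<alpha> + 1 > 0" using assms by linarith+
  thus ?thesis
    unfolding 0 by (simp add: jacobi_coeff_def pochhammer_Suc divide_simps) (simp add: algebra_simps)
next
  case (Suc j)
  \<comment> \<open>\<open>c\<close> is the second hypergeometric parameter at index
    \<open>m\<close>. \<open>A\<close>, \<open>U\<close>, \<open>V\<close> and \<open>W\<close> are
    the Pochhammer pieces to which those of indices \<open>m\<close>, \<open>m + 1\<close> and
    \<open>m + 2\<close> reduce.\<close>
  define c where "c = real m + \<alpha> + \<beta> + 1"
  define A where "A = pochhammer (\<alpha> + 1) m"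
  define U where "U = pochhammer (- real m) j"
  define V where "V = pochhammer (c + 2) j"
  define W where "W = pochhammer (\<alpha> + 1) (Suc j)"
  have pos: "2 * real m + \<alpha> + \<beta> + 3 > 0" "\<alpha> + 2 + real j > 0"
    using assms by linarith+
  have W0: "W > 0" unfolding W_def using assms by (intro pochhammer_pos) auto
  have A1: "pochhammer (\<alpha> + 1) (Suc m) = A * (\<alpha> + 1 + real m)"
    "pochhammer (\<alpha> + 1) (Suc (Suc m)) = A * (\<alpha> + 1 + real m) * (\<alpha> + 2 + real m)"
    by (simp_all add: A_def pochhammer_Suc add_ac)
  have rec: "pochhammer b (Suc n) = b * pochhammer a n" if "a = b + 1" for a b :: real and n
    by (simp add: that pochhammer_rec)
  have U1: "pochhammer (- real m) (Suc (Suc j)) = U * (real j - real m) * (real j + 1 - real m)"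
    by (simp add: U_def pochhammer_Suc add_ac)
  have U2: "pochhammer (- real (Suc m)) (Suc n) = - (real m + 1) * pochhammer (- real m) n" for n
    by (subst rec[of "- real m"]) auto
  have U3: "pochhammer (- real (Suc m)) (Suc j) = - (real m + 1) * U"
    "pochhammer (- real (Suc m)) (Suc (Suc j)) = - (real m + 1) * U * (real j - real m)"
    unfolding U2 by (simp_all add: U_def pochhammer_Suc)
  have U4: "pochhammer (- real (Suc (Suc m))) (Suc (Suc j)) = (real m + 2) * (real m + 1) * U"
    by (subst rec[of "- real (Suc m)"]) (simp, unfold U3, simp add: algebra_simps)
  have V0: "pochhammer (c + 1) (Suc n) = (c + 1) * pochhammer (c + 2) n" for n
    by (subst rec[of "c + 2"]) auto
  have c: "real m + \<alpha> + \<beta> + 1 = c" "real (Suc m) + \<alpha> + \<beta> + 1 = c + 1"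
    "real (Suc (Suc m)) + \<alpha> + \<beta> + 1 = c + 2"
    by (simp_all add: c_def)
  have V1: "pochhammer (real m + \<alpha> + \<beta> + 1) (Suc (Suc j)) = c * (c + 1) * V"
    unfolding c by (subst rec[of "c + 1"]) (simp_all add: V0 V_def)
  have V2: "pochhammer (real (Suc m) + \<alpha> + \<beta> + 1) (Suc j) = (c + 1) * V"
    "pochhammer (real (Suc m) + \<alpha> + \<beta> + 1) (Suc (Suc j)) = (c + 1) * V * (c + 2 + real j)"
    unfolding c V0 by (simp_all add: V_def pochhammer_Suc)
  have V3: "pochhammer (real (Suc (Suc m)) + \<alpha> + \<beta> + 1) (Suc (Suc j))
      = V * (c + 2 + real j) * (c + 3 + real j)"
    unfolding c by (simp add: V_def pochhammer_Suc add_ac)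
  have W1: "pochhammer (\<alpha> + 1) (Suc (Suc j)) = W * (\<alpha> + 2 + real j)"
    by (simp add: W_def pochhammer_Suc add_ac)
  \<comment> \<open>The common factor \<open>K\<close> may vanish, so it is only factored out, never cancelled.\<close>
  define K where "K = A * U * V * (- 1) ^ j / (W * fact m * fact (Suc j))"
  have C: "jacobi_coeff \<alpha> \<beta> m (Suc (Suc j)) = K * ((real j - real m) * (real j + 1 - real m) * c * (c + 1)
      / ((\<alpha> + 2 + real j) * (real j + 2)))"
    "jacobi_coeff \<alpha> \<beta> (Suc m) (Suc j) = K * ((\<alpha> + 1 + real m) * (c + 1))"
    "jacobi_coeff \<alpha> \<beta> (Suc m) (Suc (Suc j)) = K * ((\<alpha> + 1 + real m) * (c + 1)
       * (real m - real j) * (c + 2 + real j) / ((\<alpha> + 2 + real j) * (real j + 2)))"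
    "jacobi_coeff \<alpha> \<beta> (Suc (Suc m)) (Suc (Suc j)) = K * ((\<alpha> + 1 + real m) * (\<alpha> + 2 + real m)
       * (c + 2 + real j) * (c + 3 + real j) / ((\<alpha> + 2 + real j) * (real j + 2)))"
    by (simp_all only: jacobi_coeff_def A1 U1 U3 U4 V1 V2 V3 W1 A_def[symmetric] W_def[symmetric])
       (use W0 pos in \<open>simp_all add: K_def divide_simps, simp_all add: algebra_simps\<close>)
  \<comment> \<open>The cofactors of \<open>K\<close> after clearing denominators, with
    \<open>x\<close> for \<open>m\<close> and \<open>y\<close> for \<open>j\<close>; \<beta> is
    eliminated in favour of \<open>c\<close>.\<close>
  have key: "d * (- (2 * y + \<alpha> + 5) * (x - y) * (c + 2 + y) - (2 * y + c - x + 3) * ((\<alpha> + 2 + y) * (y + 2)))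
      = - (x + 2) * (\<alpha> + 2 + x) * (c + 2 + y) * (c + 3 + y) + (c - \<alpha>) * (y - x) * (y + 1 - x) * c"
    if "d = x + c + 2" for d x y :: real
    unfolding that by (simp add: algebra_simps)
  define d where "d = 2 * real m + \<alpha> + \<beta> + 3"
  define e where "e = (\<alpha> + 2 + real j) * (real j + 2)"
  have d: "d = real m + c + 2" and "d > 0" "e > 0"
    using pos by (auto simp: d_def e_def c_def)
  have \<beta>: "2 * real j + \<alpha> + \<beta> + 4 = 2 * real j + c - real m + 3" "real m + \<alpha> + \<beta> + 2 = c + 1"
    "real m + 1 + \<beta> = c - \<alpha>"
    by (simp_all add: c_def)
  \<comment> \<open>Stated for arbitrary reals so that the fractions are rearranged without
    expanding the large factors.\<close>
  have frac1: "- p * (q * r * u * v / e) - w * (q * r) = q * r * (d * (- p * u * v - w * e)) / (d * e)"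
    for p q r u v w :: real
    using \<open>d > 0\<close> \<open>e > 0\<close> by (simp add: divide_simps) (simp add: algebra_simps)
  have frac2: "q * r * (- p * u * v * w + x * y * z * c) / (d * e)
      = - (p * r / d) * (q * u * v * w / e) + q * x / d * (y * z * c * r / e)"
    for p q r u v w x y z :: real
    using \<open>d > 0\<close> \<open>e > 0\<close> by (simp add: divide_simps) (simp add: algebra_simps)
  have "- (2 * real j + \<alpha> + 5) * ((\<alpha> + 1 + real m) * (c + 1) * (real m - real j) * (c + 2 + real j) / e)
      - (2 * real j + \<alpha> + \<beta> + 4) * ((\<alpha> + 1 + real m) * (c + 1))
    = (\<alpha> + 1 + real m) * (c + 1) * (d * (- (2 * real j + \<alpha> + 5) * (real m - real j) * (c + 2 + real j)
        - (2 * real j + c - real m + 3) * e)) / (d * e)" (is "?l = _")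
    unfolding \<beta> by (rule frac1)
  also have "\<dots> = (\<alpha> + 1 + real m) * (c + 1) * (- (real m + 2) * (\<alpha> + 2 + real m) * (c + 2 + real j) * (c + 3 + real j)
        + (c - \<alpha>) * (real j - real m) * (real j + 1 - real m) * c) / (d * e)"
    unfolding e_def key[OF d] ..
  also have "\<dots> = - ((real m + 2) * (real m + \<alpha> + \<beta> + 2) / d)
        * ((\<alpha> + 1 + real m) * (\<alpha> + 2 + real m) * (c + 2 + real j) * (c + 3 + real j) / e)
    + (real m + 1 + \<alpha>) * (real m + 1 + \<beta>) / d
        * ((real j - real m) * (real j + 1 - real m) * c * (c + 1) / e)" (is "_ = ?r")
    unfolding \<beta>
    using frac2[of "\<alpha> + 1 + real m" "c + 1" "real m + 2" "\<alpha> + 2 + real m" "c + 2 + real j" "c + 3 + real j"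
        "c - \<alpha>" "real j - real m" "real j + 1 - real m"]
    by (simp only: add_ac)
  finally have "?l = ?r" .
  hence "K * ?l = K * ?r" by (rule arg_cong)
  moreover have "- p * (K * q) - w * (K * r) = - s * (K * t) + u * (K * v)"
    if "K * (- p * q - w * r) = K * (- s * t + u * v)" for p q r s t u v w :: real
    using that by (simp add: algebra_simps)
  moreover have "2 * real (Suc j) + \<alpha> + 3 = 2 * real j + \<alpha> + 5"
    "2 * real (Suc j) + \<alpha> + \<beta> + 2 = 2 * real j + \<alpha> + \<beta> + 4"
    by simp_all
  ultimately show ?thesis
    unfolding Suc C d_def[symmetric] e_def[symmetric] by metis
qed

lemma jacobi_structure_shifted:
  assumes "\<alpha> > -1" "\<beta> > -1"
  shows "[:0, -2, -2:] * pderiv (jacobi_shifted \<alpha> \<beta> (Suc m))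
      - [:\<alpha> + 1, \<alpha> + \<beta> + 2:] * jacobi_shifted \<alpha> \<beta> (Suc m) =
    smult (- ((real m + 2) * (real m + \<alpha> + \<beta> + 2) / (2 * real m + \<alpha> + \<beta> + 3)))
      (jacobi_shifted \<alpha> \<beta> (Suc (Suc m)))
    + smult ((real m + 1 + \<alpha>) * (real m + 1 + \<beta>) / (2 * real m + \<alpha> + \<beta> + 3))
      (jacobi_shifted \<alpha> \<beta> m)" (is "?l = ?r")
proof (rule poly_eqI)
  fix i
  show "coeff ?l i = coeff ?r i"
  proof (cases i)
    case 0
    have "coeff ?l i = - (\<alpha> + 1) * jacobi_coeff \<alpha> \<beta> (Suc m) 0"
      by (simp add: 0 coeff_jacobi_shifted algebra_simps)
    also have "\<dots> = coeff ?r i"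
      by (simp only: 0 coeff_add coeff_smult coeff_jacobi_shifted jacobi_coeff_structure_0[OF assms])
    finally show ?thesis .
  next
    case (Suc k)
    have "coeff ?l i = - (2 * real k + \<alpha> + 3) * jacobi_coeff \<alpha> \<beta> (Suc m) (Suc k)
      - (2 * real k + \<alpha> + \<beta> + 2) * jacobi_coeff \<alpha> \<beta> (Suc m) k"
      unfolding Suc
      by (cases k) (simp_all add: coeff_pderiv coeff_jacobi_shifted coeff_pCons algebra_simps)
    also have "\<dots> = coeff ?r i"
      by (simp only: Suc coeff_add coeff_smult coeff_jacobi_shifted jacobi_coeff_structure_Suc[OF assms])
    finally show ?thesis .
  qed
qed

text \<open>\<open>L\<close> in the variable t: (1 - x^2) d/dx becomes -2 t (1 + t) d/dt, and half
  the linear factor becomes \<alpha> + 1 + (\<alpha> + \<beta> + 2) t.\<close>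

lemma poly_jacobi_L_jacobi_explicit:
  "poly (jacobi_L \<alpha> \<beta> (jacobi_explicit \<alpha> \<beta> n)) x =
    poly ([:0, -2, -2:] * pderiv (jacobi_shifted \<alpha> \<beta> n)
      - [:\<alpha> + 1, \<alpha> + \<beta> + 2:] * jacobi_shifted \<alpha> \<beta> n) ((x - 1) / 2)"
proof -
  define t where "t = (x - 1) / 2"
  have x: "x = 1 + 2 * t" by (simp add: t_def field_simps)
  show ?thesis
    unfolding jacobi_L_def
    by (simp add: poly_jacobi_explicit poly_pderiv_jacobi_explicit flip: t_def)
       (simp add: x field_simps)
qed

lemma jacobi_structure_relation:
  assumes "\<alpha> > -1" "\<beta> > -1"
  shows "poly (jacobi_L \<alpha> \<beta> (jacobi_poly \<alpha> \<beta> (int n))) x =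
          - (if n = 0 then 1
             else (real n + 1) * (real n + \<alpha> + \<beta> + 1) / (2 * real n + \<alpha> + \<beta> + 1))
              * poly (jacobi_poly \<alpha> \<beta> (int n + 1)) x
          + (real n + \<alpha>) * (real n + \<beta>) / (2 * real n + \<alpha> + \<beta> + 1)
              * poly (jacobi_poly \<alpha> \<beta> (int n - 1)) x"
proof (cases n)
  case 0
  \<comment> \<open>The term with index -1 is 0 even if \<alpha> + \<beta> + 1 = 0 makes its
    quotient a division by 0. What remains is \<open>L 1 = - P_1\<close>.\<close>
  have "\<alpha> + 1 > 0" using assms by simp
  thus ?thesis
    by (simp add: 0 jacobi_poly_eq_explicit[OF assms] poly_jacobi_L_jacobi_explicit
        poly_jacobi_explicit)
       (simp add: jacobi_shifted_def jacobi_coeff_def poly_monom pderiv_monom field_simps)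
next
  case (Suc m)
  have nat: "nat (int (Suc m) + 1) = Suc (Suc m)" "nat (int (Suc m)) = Suc m"
    "nat (int (Suc m) - 1) = m" by simp_all
  show ?thesis
    unfolding Suc jacobi_poly_eq_explicit[OF assms] nat
    by (simp add: poly_jacobi_L_jacobi_explicit jacobi_structure_shifted[OF assms]
          poly_jacobi_explicit del: pcompose_pCons mult_pCons_left) (simp add: add_ac)
qed

section \<open>Commutator and conjugated derivative forms of \<open>L\<close>\<close>

text \<open>Commuting with \<open>X\<close> turns the second derivative into twice the first and the
  first derivative into the identity.\<close>

lemma jacobi_L_eq_commutator:
  "jacobi_L \<alpha> \<beta> = (\<lambda>f. jacobi_D \<alpha> \<beta> (mult_X f) - mult_X (jacobi_D \<alpha> \<beta> f))"
proof
  fix f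
  show "jacobi_L \<alpha> \<beta> f = jacobi_D \<alpha> \<beta> (mult_X f) - mult_X (jacobi_D \<alpha> \<beta> f)"
    by (rule poly_eq_poly_eq_iff[THEN iffD1], rule ext)
       (simp add: jacobi_L_def jacobi_D_def mult_X_def pderiv_mult pderiv_pCons pderiv_add field_simps)
qed

lemma jacobi_L_conjugated_derivative:
  assumes "x \<in> {-1<..<1}"
  shows "((\<lambda>y. (1 - y) powr (\<alpha>/2 + 1/2) * (1 + y) powr (\<beta>/2 + 1/2) * poly f y)
     has_real_derivative
       (1 - x) powr (\<alpha>/2 - 1/2) * (1 + x) powr (\<beta>/2 - 1/2) * poly (jacobi_L \<alpha> \<beta> f) x) (at x)"
proof -
  \<comment> \<open>Splitting off one linear factor brings every term of the product rule to the
    powers (\<alpha> - 1) / 2 and (\<beta> - 1) / 2.\<close>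
  have "(1 - x) powr (\<alpha>/2 + 1/2) = (1 - x) * (1 - x) powr (\<alpha>/2 - 1/2)"
    "(1 + x) powr (\<beta>/2 + 1/2) = (1 + x) * (1 + x) powr (\<beta>/2 - 1/2)"
    using assms powr_mult_base[of "1 - x" "\<alpha>/2 - 1/2"] powr_mult_base[of "1 + x" "\<beta>/2 - 1/2"]
    by (simp_all add: add_ac)
  moreover have "\<alpha>/2 + 1/2 - 1 = \<alpha>/2 - 1/2" "\<beta>/2 + 1/2 - 1 = \<beta>/2 - 1/2" by simp_all
  ultimately show ?thesis
    using assms
    by (auto intro!: derivative_eq_intros simp: jacobi_L_def) (simp add: field_simps)
qed

theorem mainTheorem7:
  fixes \<alpha> \<beta> :: real
  assumes "\<alpha> > -1" and "\<beta> > -1"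
  shows "(\<forall>f g. jacobi_inner \<alpha> \<beta> (jacobi_L \<alpha> \<beta> f) g = - jacobi_inner \<alpha> \<beta> f (jacobi_L \<alpha> \<beta> g))
    \<and> (\<forall>f. \<forall>x\<in>{-1<..<1}.
          (\<lambda>y. (1 - y) powr (\<alpha>/2 + 1/2) * (1 + y) powr (\<beta>/2 + 1/2) * poly f y)
            field_differentiable (at x) \<and>
          poly (jacobi_L \<alpha> \<beta> f) x =
            (1 - x) powr (- \<alpha>/2 + 1/2) * (1 + x) powr (- \<beta>/2 + 1/2) *
            deriv (\<lambda>y. (1 - y) powr (\<alpha>/2 + 1/2) * (1 + y) powr (\<beta>/2 + 1/2) * poly f y) x)
    \<and> jacobi_L \<alpha> \<beta> = (\<lambda>f. jacobi_D \<alpha> \<beta> (mult_X f) - mult_X (jacobi_D \<alpha> \<beta> f))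
    \<and> (\<forall>(n::nat) (x::real).
          (1 - x\<^sup>2) * deriv (poly (jacobi_poly \<alpha> \<beta> (int n))) x
            - 1/2 * (\<alpha> - \<beta> + (\<alpha> + \<beta> + 2) * x) * poly (jacobi_poly \<alpha> \<beta> (int n)) x =
          - (if n = 0 then 1
             else (real n + 1) * (real n + \<alpha> + \<beta> + 1) / (2 * real n + \<alpha> + \<beta> + 1))
              * poly (jacobi_poly \<alpha> \<beta> (int n + 1)) x
          + (real n + \<alpha>) * (real n + \<beta>) / (2 * real n + \<alpha> + \<beta> + 1)
              * poly (jacobi_poly \<alpha> \<beta> (int n - 1)) x)"
proof (intro conjI allI ballI)
  fix f g
  show "jacobi_inner \<alpha> \<beta> (jacobi_L \<alpha> \<beta> f) g = - jacobi_inner \<alpha> \<beta> f (jacobi_L \<alpha> \<beta> g)"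
    by (rule jacobi_L_antisymmetric[OF assms])
next
  fix f and x :: real
  assume x: "x \<in> {-1<..<1}"
  note d = jacobi_L_conjugated_derivative[OF x, of \<alpha> \<beta> f]
  show "(\<lambda>y. (1 - y) powr (\<alpha>/2 + 1/2) * (1 + y) powr (\<beta>/2 + 1/2) * poly f y)
            field_differentiable (at x)"
    using d by (auto simp: field_differentiable_def)
  \<comment> \<open>The exponents sum to 0, and the bases are nonzero because x is interior, so the
    prefactors cancel.\<close>
  have "(1 - x) powr (- \<alpha>/2 + 1/2) * (1 - x) powr (\<alpha>/2 - 1/2) = 1"
    "(1 + x) powr (- \<beta>/2 + 1/2) * (1 + x) powr (\<beta>/2 - 1/2) = 1"
    using x by (auto simp flip: powr_add)
  moreover have "p * q * (r * s * z) = (p * r) * (q * s) * z" for p q r s z :: real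
    by simp
  ultimately show "poly (jacobi_L \<alpha> \<beta> f) x =
            (1 - x) powr (- \<alpha>/2 + 1/2) * (1 + x) powr (- \<beta>/2 + 1/2) *
            deriv (\<lambda>y. (1 - y) powr (\<alpha>/2 + 1/2) * (1 + y) powr (\<beta>/2 + 1/2) * poly f y) x"
    unfolding DERIV_imp_deriv[OF d] by (simp only: mult_1)
next
  show "jacobi_L \<alpha> \<beta> = (\<lambda>f. jacobi_D \<alpha> \<beta> (mult_X f) - mult_X (jacobi_D \<alpha> \<beta> f))"
    by (rule jacobi_L_eq_commutator)
next
  fix n :: nat and x :: real
  let ?P = "jacobi_poly \<alpha> \<beta> (int n)"
  have "(1 - x\<^sup>2) * deriv (poly ?P) x - 1/2 * (\<alpha> - \<beta> + (\<alpha> + \<beta> + 2) * x) * poly ?P x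
      = poly (jacobi_L \<alpha> \<beta> ?P) x"
    by (simp add: DERIV_imp_deriv[OF poly_DERIV] jacobi_L_def power2_eq_square field_simps)
  also note jacobi_structure_relation[OF assms]
  finally show "(1 - x\<^sup>2) * deriv (poly (jacobi_poly \<alpha> \<beta> (int n))) x
            - 1/2 * (\<alpha> - \<beta> + (\<alpha> + \<beta> + 2) * x) * poly (jacobi_poly \<alpha> \<beta> (int n)) x =
          - (if n = 0 then 1
             else (real n + 1) * (real n + \<alpha> + \<beta> + 1) / (2 * real n + \<alpha> + \<beta> + 1))
              * poly (jacobi_poly \<alpha> \<beta> (int n + 1)) x
          + (real n + \<alpha>) * (real n + \<beta>) / (2 * real n + \<alpha> + \<beta> + 1)
              * poly (jacobi_poly \<alpha> \<beta> (int n - 1)) x" .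
qed

end
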